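(* For each and every cycle $C$ in the Loosened Collatz graph, with $g$ applied $n$ times in $C$, there exists a unique object in $\mathbb{R}^{n}$ representing $C$.
   Context: $\mathbb{N}_1$ denotes the positive integers. Let $f:m\mapsto m/2$ (applied only to even $m$) and $g:m\mapsto 3m+1$. The Loosened Collatz graph is the directed graph with vertex set $\mathbb{N}_1$ having an edge $m\to 3m+1$ (the $g$-edge) for every $m\in\mathbb{N}_1$ and an edge $m\to m/2$ (the $f$-edge) for every even $m\in\mathbb{N}_1$. A cycle is a simple directed circuit in this graph; $f$ (resp. $g$) is applied to a vertex in the cycle if the cycle leaves that vertex along its $f$-edge (resp. $g$-edge). Tuples representing a cycle: given a cycle $C$ in which $g$ is applied $n$ times, pick a vertex $x_1$ of $C$ to which $g$ is applied; let $y_1\ge0$ be the number of applications of $f$ after $g$ is applied to $x_1$ and before $g$ is applied again, $x_2=f^{y_1}(g(x_1))$ the vertex to which $g$ is next applied, and so on, $x_{i+1}=f^{y_i}(g(x_i))$ for $1\le i<n$ and $x_1=f^{y_n}(g(x_n))$. The tuple $Y=(y_1,\dots,y_n)$ represents $C$; different choices of the vertex $x_1$ give the bitwise rotations of one tuple, where the bitwise rotation is $R(a_1,a_2,\dots,a_n)=(a_2,\dots,a_n,a_1)$. The length of the tuple (the number of times $g$ is applied in $C$) is $n$. Object of a tuple: interpret $Y=(y_1,\dots,y_n)$ as a point of $\mathbb{R}^n$. The object generated by $Y$ is the polygon in $\mathbb{R}^n$ with vertices $Y,R(Y),\dots,R^{n-1}(Y)$ (note $R^n(Y)=Y$) and edges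 $L_1,\dots,L_n$, where $L_i$ is the edge from $R^{i-1}(Y)$ to $R^i(Y)$ for $1\le i<n$ and $L_n$ is the edge from $R^{n-1}(Y)$ to $Y$. An object in $\mathbb{R}^n$ represents $C$ if it is the object generated by a tuple representing $C$; objects are compared by their sets of vertices and edges. *)

theory Defs
  imports "Graph_Theory.Arc_Walk" "Jordan_Normal_Form.Matrix"
begin

datatype op = F | G

fun apply_op :: "op \<Rightarrow> nat \<Rightarrow> nat" where
  "apply_op F m = m div 2"
| "apply_op G m = 3 * m + 1"

(* An arc (m, a) leaves the vertex m by applying a. F is allowed at even m only,
   where the truncating division is exact. *)
definition loosened_collatz :: "(nat, nat \<times> op) pre_digraph" where
  "loosened_collatz = \<lparr>
     verts = {m. 1 \<le> m},
     arcs = {(m, G) | m. 1 \<le> m} \<union> {(m, F) | m. 1 \<le> m \<and> even m},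
     tail = fst,
     head = (\<lambda>(m, a). apply_op a m) \<rparr>"

(* A cycle is given by its list of arcs. The list has a starting point, but the notions
   below depend only on its set of arcs and on the number of its G-arcs, so they are
   invariant under rotating it. *)
abbreviation collatz_cycle :: "(nat \<times> op) list \<Rightarrow> bool" where
  "collatz_cycle \<equiv> pre_digraph.cycle loosened_collatz"

definition applied_at :: "(nat \<times> op) list \<Rightarrow> op \<Rightarrow> nat \<Rightarrow> bool" where
  "applied_at C a m \<longleftrightarrow> (m, a) \<in> set C"

definition g_count :: "(nat \<times> op) list \<Rightarrow> nat" where
  "g_count C = length (filter (\<lambda>e. snd e = G) C)"

(* Indices start at 0: x i and Y ! i are the usual x_(i+1) and y_(i+1). The third conjunct
   says that the Y ! i applications of F following the G at x i are made along C and that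
   the next operation along C is G; as length Y = g_count C, one goes round C exactly once. *)
definition tuple_represents :: "nat list \<Rightarrow> (nat \<times> op) list \<Rightarrow> bool" where
  "tuple_represents Y C \<longleftrightarrow> length Y = g_count C \<and>
     (\<exists>x :: nat \<Rightarrow> nat. applied_at C G (x 0) \<and>
       (\<forall>i < length Y.
          (\<forall>j < Y ! i. applied_at C F ((apply_op F ^^ j) (apply_op G (x i)))) \<and>
          applied_at C G ((apply_op F ^^ (Y ! i)) (apply_op G (x i))) \<and>
          x (Suc i mod length Y) = (apply_op F ^^ (Y ! i)) (apply_op G (x i))))"

definition point :: "nat list \<Rightarrow> real vec" where
  "point Y = vec_of_list (map real Y)"

definition segment :: "real vec \<Rightarrow> real vec \<Rightarrow> real vec set" where
  "segment a b = {(1 - t) \<cdot>\<^sub>v a + t \<cdot>\<^sub>v b | t. 0 \<le> t \<and> t \<le> 1}"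

record polygon =
  vertices :: "real vec set"
  edges :: "real vec set set"

definition object_of :: "nat list \<Rightarrow> polygon" where
  "object_of Y = (let n = length Y in \<lparr>
     vertices = {point (rotate i Y) | i. i < n},
     edges = {segment (point (rotate (i - 1) Y)) (point (rotate i Y)) | i. 1 \<le> i \<and> i < n}
             \<union> {segment (point (rotate (n - 1) Y)) (point Y)} \<rparr>)"

definition polygon_in :: "nat \<Rightarrow> polygon \<Rightarrow> bool" where
  "polygon_in n P \<longleftrightarrow> vertices P \<subseteq> carrier_vec n \<and> (\<forall>L \<in> edges P. L \<subseteq> carrier_vec n)"

definition object_represents :: "polygon \<Rightarrow> (nat \<times> op) list \<Rightarrow> bool" where
  "object_represents P C \<longleftrightarrow> (\<exists>Y. tuple_represents Y C \<and> P = object_of Y)"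

end

theory Submission
  imports Defs "HOL-Library.Infinite_Set"
begin

text \<open>
  Read a cycle \<open>C\<close> as a periodic sequence: position \<open>k\<close> is the \<open>k\<close>-th arc met when running round
  \<open>C\<close> for ever. The vertices of \<open>C\<close> are distinct, so at every vertex exactly one operation
  is applied, and the vertex alone decides which one. Since halving decreases positive
  numbers, \<open>G\<close> is applied somewhere, hence at infinitely many positions
  \<open>gpos 0 < gpos 1 < \<dots>\<close>. One round meets \<open>n\<close> of them, so \<open>gpos (i + n) = gpos i + length C\<close>
  (\<open>enumerate_periodic\<close>) and the gaps \<open>gpos (Suc i) - Suc (gpos i)\<close>, which count the \<open>F\<close>s between
  consecutive \<open>G\<close>s, have period \<open>n\<close>.

  A representing tuple is a window of \<open>n\<close> consecutive gaps: its first entry starts at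
  some \<open>gpos m\<close>, and from there every entry is forced, since the run of \<open>F\<close>s must stop
  exactly where \<open>C\<close> applies \<open>G\<close> again (\<open>represents_imp_window\<close>); conversely the window at \<open>0\<close>
  represents \<open>C\<close> (\<open>window_represents\<close>). By periodicity, sliding the window by one place rotates it,
  so any two representing tuples are rotations of each other. The object of a tuple is
  the closed polygon through all its rotations and does not notice where the tour of
  them begins (\<open>object_of_rotate\<close>).
\<close>

section \<open>Objects are invariant under rotation\<close>

text \<open>
  Letting the indices run through all of \<open>\<nat>\<close> absorbs the closing edge, since
  \<open>rotate (length Y) Y = Y\<close>.
\<close>

lemma object_of_range:
  assumes "Y \<noteq> []"
  shows "object_of Y = \<lparr>vertices = range (\<lambda>i. point (rotate i Y)),
           edges = range (\<lambda>i. segment (point (rotate i Y)) (point (rotate (Suc i) Y)))\<rparr>"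
proof -
  define n where "n = length Y"
  define P where "P i = point (rotate i Y)" for i
  have n: "0 < n" using assms by (simp add: n_def)
  have P_mod: "P (i mod n) = P i" for i
    unfolding P_def n_def by (metis rotate_conv_mod)
  have P_Suc_mod: "P (Suc (i mod n)) = P (Suc i)" for i
    by (metis P_mod mod_Suc_eq)
  have verts: "{P i | i. i < n} = range P"
  proof
    show "range P \<subseteq> {P i | i. i < n}"
    proof
      fix p assume "p \<in> range P"
      then obtain i where "p = P i" by blast
      then have "p = P (i mod n)" "i mod n < n" using P_mod n by simp_all
      then show "p \<in> {P i | i. i < n}" by blast
    qed
  qed blast
  have "P n = P 0" using P_mod[of n] by simp
  have edges: "{segment (P (i - 1)) (P i) | i. 1 \<le> i \<and> i < n} \<union> {segment (P (n - 1)) (P 0)}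
      = range (\<lambda>i. segment (P i) (P (Suc i)))" (is "?A = ?B")
  proof
    show "?A \<subseteq> ?B"
    proof
      fix L assume "L \<in> ?A"
      then obtain i where "1 \<le> i" "L = segment (P (i - 1)) (P i)"
        using n \<open>P n = P 0\<close> by (auto simp: Suc_le_eq)
      then have "L = segment (P (i - 1)) (P (Suc (i - 1)))" by simp
      then show "L \<in> ?B" by blast
    qed
  next
    show "?B \<subseteq> ?A"
    proof
      fix L assume "L \<in> ?B"
      then obtain i where "L = segment (P i) (P (Suc i))" by blast
      then have L: "L = segment (P (i mod n)) (P (Suc (i mod n)))"
        using P_mod P_Suc_mod by simp
      show "L \<in> ?A"
      proof (cases "Suc (i mod n) < n")
        case True
        then show ?thesis using L by (auto intro!: exI[of _ "Suc (i mod n)"])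
      next
        case False
        moreover have "i mod n < n" using n by simp
        ultimately have "Suc (i mod n) = n" by linarith
        then have "L = segment (P (n - 1)) (P 0)"
          using L \<open>P n = P 0\<close> by (metis diff_Suc_1)
        then show ?thesis by blast
      qed
    qed
  qed
  show ?thesis
    using verts edges unfolding object_of_def Let_def P_def n_def by simp
qed

lemma object_of_rotate1: "object_of (rotate1 Y) = object_of Y"
proof (cases "Y = []")
  case False
  have shift: "rotate i (rotate1 Y) = rotate (Suc i) Y" for i
    by (simp add: rotate1_rotate_swap)
  have period: "rotate i Y = rotate (Suc (i + (length Y - 1))) Y" for i
  proof -
    have "Suc (i + (length Y - 1)) = i + length Y" using False by (cases Y) auto
    then show ?thesis by (metis mod_add_self2 rotate_conv_mod)
  qed
  have reindex: "range (\<lambda>i. f (Suc i)) = range f" if "\<And>i. f i = f (Suc (i + (length Y - 1)))"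
    for f :: "nat \<Rightarrow> 'a"
  proof
    show "range f \<subseteq> range (\<lambda>i. f (Suc i))"
      by (rule image_subsetI) (subst that, rule rangeI)
  qed blast
  have "range (\<lambda>i. point (rotate (Suc i) Y)) = range (\<lambda>i. point (rotate i Y))"
    using period by (intro reindex) metis
  moreover have
    "range (\<lambda>i. segment (point (rotate (Suc i) Y)) (point (rotate (Suc (Suc i)) Y)))
      = range (\<lambda>i. segment (point (rotate i Y)) (point (rotate (Suc i) Y)))"
    using period by (intro reindex) (metis add_Suc)
  ultimately show ?thesis
    using False by (simp add: object_of_range shift del: rotate_Suc)
qed simp

lemma object_of_rotate: "object_of (rotate m Y) = object_of Y"
  by (induction m) (simp_all add: object_of_rotate1)

lemma polygon_in_object_of:
  assumes "Y \<noteq> []"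
  shows "polygon_in (length Y) (object_of Y)"
proof -
  have "point (rotate i Y) \<in> carrier_vec (length Y)" for i
    unfolding point_def by (metis carrier_vec_dim_vec dim_vec_of_list length_map length_rotate)
  moreover have "segment a b \<subseteq> carrier_vec m"
    if "a \<in> carrier_vec m" "b \<in> carrier_vec m" for a b m
    using that by (auto simp: segment_def)
  ultimately show ?thesis
    using assms by (auto simp: polygon_in_def object_of_range simp del: rotate_Suc)
qed

section \<open>Enumerating periodic sets of naturals\<close>

lemma card_below_enumerate:
  fixes S :: "nat set"
  assumes "infinite S"
  shows "card (S \<inter> {..<enumerate S i}) = i"
proof -
  have "S \<inter> {..<enumerate S i} = enumerate S ` {..<i}"
    using assms by (auto simp: enumerate_in_set dest!: enumerate_Ex[OF assms])
  then show ?thesis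
    using inj_enumerate[OF assms] by (simp add: card_image inj_on_subset)
qed

text \<open>
  An element of \<open>S\<close> is determined by how many elements lie below it. Below
  \<open>enumerate S i + L\<close> there is one full period, contributing \<open>card (S \<inter> {..<L})\<close>, and a
  translate of the part of \<open>S\<close> below \<open>enumerate S i\<close>.
\<close>

lemma enumerate_periodic:
  fixes S :: "nat set"
  assumes inf: "infinite S" and per: "\<And>k. k + L \<in> S \<longleftrightarrow> k \<in> S"
  shows "enumerate S (i + card (S \<inter> {..<L})) = enumerate S i + L"
proof -
  let ?e = "enumerate S i"
  have "?e + L \<in> S" using per enumerate_in_set[OF inf] by simp
  then obtain j where j: "enumerate S j = ?e + L" using enumerate_Ex[OF inf] by blast
  have split: "S \<inter> {..<?e + L} = (S \<inter> {..<L}) \<union> (\<lambda>k. k + L) ` (S \<inter> {..<?e})" (is "?A = ?B")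
  proof
    show "?A \<subseteq> ?B"
    proof
      fix k assume k: "k \<in> ?A"
      show "k \<in> ?B"
      proof (cases "k < L")
        case False
        then have "k = (k - L) + L" by simp
        moreover have "k - L \<in> S \<inter> {..<?e}" using k per[of "k - L"] False by auto
        ultimately show ?thesis by blast
      qed (use k in auto)
    qed
  qed (use per in auto)
  have "card ?A = card (S \<inter> {..<L}) + card ((\<lambda>k. k + L) ` (S \<inter> {..<?e}))"
    unfolding split by (rule card_Un_disjoint) auto
  also have "\<dots> = card (S \<inter> {..<L}) + i"
    by (simp add: card_image card_below_enumerate[OF inf])
  finally have "j = card (S \<inter> {..<L}) + i"
    using card_below_enumerate[OF inf, of j] j by simp
  then show ?thesis using j by (simp add: add.commute)
qed

lemma enumerate_Suc_eqI:
  fixes S :: "nat set"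
  assumes "infinite S" "k \<in> S" "enumerate S i < k"
    and "\<And>l. enumerate S i < l \<Longrightarrow> l < k \<Longrightarrow> l \<notin> S"
  shows "enumerate S (Suc i) = k"
  unfolding enumerate_Suc''[OF assms(1)]
  using assms(2-4) by (intro Least_equality) (auto simp: not_less[symmetric])

lemma between_enumerate_notin:
  fixes S :: "nat set"
  assumes "infinite S" "enumerate S i < l" "l < enumerate S (Suc i)"
  shows "l \<notin> S"
  using assms not_less_Least unfolding enumerate_Suc''[OF assms(1)] by blast

section \<open>A cycle as a periodic sequence\<close>

locale loosened_cycle =
  fixes C :: "(nat \<times> op) list"
  assumes cycle: "collatz_cycle C"
begin

definition vtx :: "nat \<Rightarrow> nat" where
  "vtx k = fst (C ! (k mod length C))"

definition act :: "nat \<Rightarrow> op" where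
  "act k = snd (C ! (k mod length C))"

lemma nonempty: "C \<noteq> []"
  using cycle unfolding pre_digraph.cycle_def by blast

text \<open>
  The two ways of listing the vertices of a closed walk, by tails with the end point
  appended and by heads with the starting point prepended, give the same list. Hence
  distinctness, imposed on the heads by the notion of a cycle, passes to the tails.
\<close>

lemma
  shows distinct_tails: "distinct (map fst C)"
    and heads_eq_rotate1_tails:
      "map (\<lambda>e. apply_op (snd e) (fst e)) C = rotate1 (map fst C)"
proof -
  let ?heads = "map (\<lambda>e. apply_op (snd e) (fst e)) C" and ?tails = "map fst C"
  have G: "tail loosened_collatz = fst"
    "head loosened_collatz = (\<lambda>e. apply_op (snd e) (fst e))"
    by (auto simp: loosened_collatz_def)
  obtain u where walk: "pre_digraph.awalk loosened_collatz u C u"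
    and dist: "distinct (tl (pre_digraph.awalk_verts loosened_collatz u C))"
    using cycle by (auto simp: pre_digraph.cycle_def)
  have cas: "pre_digraph.cas loosened_collatz u C u"
    using walk by (simp add: pre_digraph.awalk_def)
  have verts: "pre_digraph.awalk_verts loosened_collatz u C = hd ?tails # ?heads"
    using pre_digraph.awalk_verts_conv'[OF cas] nonempty by (simp add: G hd_map)
  moreover have
    "pre_digraph.awalk_verts loosened_collatz u C = ?tails @ [apply_op (snd (last C)) (fst (last C))]"
    using nonempty by (simp add: pre_digraph.awalk_verts_conv G)
  moreover have "hd ?tails = apply_op (snd (last C)) (fst (last C))"
  proof -
    have "pre_digraph.cas loosened_collatz u p w \<Longrightarrow> p \<noteq> [] \<Longrightarrow>
        fst (hd p) = u \<and> apply_op (snd (last p)) (fst (last p)) = w" for p w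
      by (induction p arbitrary: u) (auto simp: pre_digraph.cas.simps G)
    then show ?thesis using cas nonempty by (simp add: hd_map)
  qed
  ultimately have "hd ?tails # ?heads = ?tails @ [hd ?tails]" by simp
  moreover have "?tails = hd ?tails # tl ?tails" using nonempty by simp
  ultimately show eq: "?heads = rotate1 ?tails"
    by (metis append_Cons list.inject rotate1.simps(2))
  show "distinct ?tails"
    using dist verts eq by (metis distinct1_rotate list.sel(3))
qed

lemma vtx_Suc: "vtx (Suc k) = apply_op (act k) (vtx k)"
proof -
  let ?k = "k mod length C"
  have k: "?k < length C" using nonempty by simp
  have "apply_op (act k) (vtx k) = map (\<lambda>e. apply_op (snd e) (fst e)) C ! ?k"
    using k by (simp add: vtx_def act_def)
  also have "\<dots> = map fst C ! (Suc ?k mod length C)"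
    using k by (simp add: heads_eq_rotate1_tails nth_rotate1 del: nth_map)
  also have "\<dots> = vtx (Suc k)"
    using nonempty by (simp add: vtx_def mod_Suc_eq)
  finally show ?thesis by simp
qed

lemma vtx_period: "vtx (k + length C) = vtx k"
  by (simp add: vtx_def)

lemma act_period: "act (k + length C) = act k"
  by (simp add: act_def)

lemma vtx_pos: "1 \<le> vtx k"
proof -
  have "C ! (k mod length C) \<in> arcs loosened_collatz"
    using cycle nonempty nth_mem[of "k mod length C" C]
    by (auto simp: pre_digraph.cycle_def pre_digraph.awalk_def simp del: nth_mem)
  then show ?thesis by (auto simp: loosened_collatz_def vtx_def)
qed

text \<open>
  The vertex determines the operation applied at it, because it is the tail of only one arc
  of \<open>C\<close>. This is what leaves no choice in a representing tuple beyond its first vertex.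
\<close>

lemma applied_at_vtx_iff: "applied_at C a (vtx k) \<longleftrightarrow> act k = a"
proof
  let ?k = "k mod length C"
  have k: "?k < length C" using nonempty by simp
  assume "applied_at C a (vtx k)"
  then obtain j where j: "j < length C" "C ! j = (vtx k, a)"
    by (auto simp: applied_at_def in_set_conv_nth)
  then have "map fst C ! j = map fst C ! ?k" using k by (simp add: vtx_def)
  then have "j = ?k"
    using j k distinct_tails nth_eq_iff_index_eq by (metis length_map)
  then show "act k = a" using j by (simp add: act_def)
next
  assume "act k = a"
  then show "applied_at C a (vtx k)"
    using nonempty by (auto simp: applied_at_def act_def vtx_def)
qed

lemma applied_at_imp_vtx:
  assumes "applied_at C a m"
  obtains k where "m = vtx k" "act k = a"
  using assms by (auto simp: applied_at_def in_set_conv_nth vtx_def act_def)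
    (metis fst_conv mod_less snd_conv)

definition g_positions :: "nat set" where
  "g_positions = {k. act k = G}"

lemma notin_g_positions_iff: "k \<notin> g_positions \<longleftrightarrow> act k = F"
  by (cases "act k") (auto simp: g_positions_def)

text \<open>
  Without a \<open>G\<close>, the vertices would decrease strictly along the cycle and never return;
  one \<open>G\<close> recurs in every period.
\<close>

lemma infinite_g_positions: "infinite g_positions"
proof -
  have "\<exists>k. act k = G"
  proof (rule ccontr)
    assume "\<nexists>k. act k = G"
    then have "vtx (Suc k) < vtx k" for k
      using vtx_Suc[of k] vtx_pos[of k] by (cases "act k") auto
    then have dec: "Suc (vtx (Suc k)) \<le> vtx k" for k by (simp add: Suc_le_eq)
    have "vtx k + k \<le> vtx 0" for k
    proof (induction k)
      case (Suc k)
      then show ?case using dec[of k] by linarith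
    qed simp
    from this[of "Suc (vtx 0)"] show False by simp
  qed
  then obtain k where "act k = G" ..
  have *: "act (k + i * length C) = G" for i
    using \<open>act k = G\<close> by (simp add: act_def)
  show ?thesis
    unfolding infinite_nat_iff_unbounded
  proof
    fix m
    obtain l where "length C = Suc l" using nonempty by (cases C) auto
    then have "m < k + Suc m * length C" by simp
    then show "\<exists>j>m. j \<in> g_positions" using *[of "Suc m"] unfolding g_positions_def by blast
  qed
qed

lemma card_g_positions: "card (g_positions \<inter> {..<length C}) = g_count C"
proof -
  have "g_positions \<inter> {..<length C} = {i. i < length C \<and> snd (C ! i) = G}"
    by (auto simp: g_positions_def act_def)
  then show ?thesis by (simp add: g_count_def length_filter_conv_card)
qed

section \<open>Representing tuples are windows of gaps\<close>

definition gpos :: "nat \<Rightarrow> nat" where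
  "gpos = enumerate g_positions"

definition gap :: "nat \<Rightarrow> nat" where
  "gap i = gpos (Suc i) - Suc (gpos i)"

definition window :: "nat \<Rightarrow> nat list" where
  "window m = map gap [m..<m + g_count C]"

lemma act_gpos: "act (gpos i) = G"
  using enumerate_in_set[OF infinite_g_positions] by (auto simp: gpos_def g_positions_def)

lemma gpos_Suc: "gpos (Suc i) = Suc (gpos i) + gap i"
  using enumerate_step[OF infinite_g_positions, of i] by (simp add: gap_def gpos_def)

lemma gpos_period: "gpos (i + g_count C) = gpos i + length C"
  unfolding gpos_def card_g_positions[symmetric]
  by (rule enumerate_periodic[OF infinite_g_positions]) (simp add: g_positions_def act_period)

lemma gap_period: "gap (i + g_count C) = gap i"
  using gpos_period[of i] gpos_period[of "Suc i"] by (simp add: gap_def)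

lemma g_count_pos: "0 < g_count C"
  using gpos_period[of 0] nonempty by (cases "g_count C") auto

lemma rotate1_window: "rotate1 (window m) = window (Suc m)"
proof -
  have "window m = gap m # map gap [Suc m..<m + g_count C]"
    using g_count_pos by (simp add: window_def upt_conv_Cons)
  moreover have "window (Suc m) = map gap [Suc m..<m + g_count C] @ [gap m]"
    using g_count_pos gap_period[of m] by (simp add: window_def)
  ultimately show ?thesis by simp
qed

lemma window_eq_rotate: "window m = rotate m (window 0)"
  by (induction m) (simp_all add: rotate1_window[symmetric])

lemma vtx_after_run:
  assumes "act k = G" "\<forall>j<y. act (Suc k + j) = F"
  shows "vtx (Suc k + y) = (apply_op F ^^ y) (apply_op G (vtx k))"
  using assms(2)
proof (induction y)
  case 0
  then show ?case using assms(1) by (simp add: vtx_Suc)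
next
  case (Suc y)
  then show ?case by (simp add: vtx_Suc[of "Suc (k + y)"])
qed

text \<open>
  Knowing that \<open>F\<close> is applied at the \<open>j\<close>-th iterate tells which arc \<open>C\<close> follows there only
  once that iterate is known to be the vertex at position \<open>Suc k + j\<close>; hence the
  induction alternates with \<open>vtx_after_run\<close>.
\<close>

lemma act_F_on_run:
  assumes "act k = G"
    and "\<forall>j<y. applied_at C F ((apply_op F ^^ j) (apply_op G (vtx k)))"
  shows "\<forall>j<y. act (Suc k + j) = F"
  using assms(2)
proof (induction y)
  case (Suc y)
  then have F: "\<forall>j<y. act (Suc k + j) = F" by simp
  have "applied_at C F (vtx (Suc k + y))"
    using Suc.prems unfolding vtx_after_run[OF assms(1) F] by blast
  then show ?case using F applied_at_vtx_iff less_Suc_eq by auto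
qed simp

lemma act_in_gap:
  assumes "j < gap i"
  shows "act (Suc (gpos i) + j) = F"
proof -
  have "Suc (gpos i) + j \<notin> g_positions"
    using assms gpos_Suc[of i] unfolding gpos_def
    by (intro between_enumerate_notin[OF infinite_g_positions, of i]) auto
  then show ?thesis by (simp only: notin_g_positions_iff)
qed

lemma iterate_in_gap:
  assumes "j \<le> gap i"
  shows "(apply_op F ^^ j) (apply_op G (vtx (gpos i))) = vtx (Suc (gpos i) + j)"
  using vtx_after_run[OF act_gpos, of j i] act_in_gap assms by simp

lemma window_represents: "tuple_represents (window 0) C"
proof -
  let ?n = "g_count C" and ?x = "\<lambda>i. vtx (gpos i)"
  have nth: "window 0 ! i = gap i" if "i < ?n" for i
    using that by (simp add: window_def)
  have len: "length (window 0) = ?n" by (simp add: window_def)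
  have run: "applied_at C F ((apply_op F ^^ j) (apply_op G (?x i)))" if "j < gap i" for i j
    using that iterate_in_gap[of j i] act_in_gap[of j i] by (simp only: applied_at_vtx_iff less_imp_le)
  have stop: "(apply_op F ^^ gap i) (apply_op G (?x i)) = ?x (Suc i)" for i
    by (simp only: iterate_in_gap gpos_Suc order_refl)
  have wrap: "?x (Suc i mod ?n) = ?x (Suc i)" if "i < ?n" for i
  proof (cases "Suc i = ?n")
    case True
    \<comment> \<open>After \<open>g_count C\<close> entries the position has advanced by one full round.\<close>
    then show ?thesis using gpos_period[of 0] vtx_period by simp
  next
    case False
    then show ?thesis using that by simp
  qed
  show ?thesis
    unfolding tuple_represents_def len
    by (intro conjI exI[of _ ?x] allI impI refl)
      (simp_all only: nth run stop wrap act_gpos applied_at_vtx_iff)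
qed

text \<open>
  A run of \<open>F\<close>s that starts after a \<open>G\<close> and is stopped by a \<open>G\<close> ends at the next \<open>G\<close>-position:
  it cannot stop early, where \<open>C\<close> applies only \<open>F\<close>, nor run through a vertex where \<open>C\<close>
  applies \<open>G\<close>.
\<close>

lemma gap_eqI:
  assumes "\<forall>j<y. applied_at C F ((apply_op F ^^ j) (apply_op G (vtx (gpos i))))"
    and "applied_at C G ((apply_op F ^^ y) (apply_op G (vtx (gpos i))))"
  shows "y = gap i"
proof -
  have F: "\<forall>j<y. act (Suc (gpos i) + j) = F" by (rule act_F_on_run[OF act_gpos assms(1)])
  have "act (Suc (gpos i) + y) = G"
    using assms(2) vtx_after_run[OF act_gpos F] applied_at_vtx_iff by metis
  then have "Suc (gpos i) + y \<in> g_positions" unfolding g_positions_def by blast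
  moreover have "l \<notin> g_positions" if "gpos i < l" "l < Suc (gpos i) + y" for l
    using F that notin_g_positions_iff
    by (metis Suc_leI add_less_cancel_left le_add_diff_inverse)
  moreover have "gpos i < Suc (gpos i) + y" by simp
  ultimately have "gpos (Suc i) = Suc (gpos i) + y"
    unfolding gpos_def using enumerate_Suc_eqI[OF infinite_g_positions] by blast
  then show ?thesis by (simp add: gap_def)
qed

text \<open>
  The vertex \<open>x 0\<close> sits at some \<open>gpos m\<close>. Inductively \<open>x i\<close> sits at \<open>gpos (m + i)\<close>,
  so \<open>gap_eqI\<close> forces the \<open>i\<close>-th entry and with it the vertex \<open>x (Suc i)\<close>.
\<close>

lemma represents_imp_window:
  assumes "tuple_represents Y C"
  obtains m where "Y = window m"
proof -
  let ?n = "g_count C"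
  obtain x where len: "length Y = ?n" and x0: "applied_at C G (x 0)"
    and run: "\<And>i j. i < ?n \<Longrightarrow> j < Y ! i \<Longrightarrow>
        applied_at C F ((apply_op F ^^ j) (apply_op G (x i)))"
    and stop: "\<And>i. i < ?n \<Longrightarrow> applied_at C G ((apply_op F ^^ (Y ! i)) (apply_op G (x i)))"
    and nxt: "\<And>i. i < ?n \<Longrightarrow> x (Suc i mod ?n) = (apply_op F ^^ (Y ! i)) (apply_op G (x i))"
    using assms unfolding tuple_represents_def by metis
  obtain k where k: "x 0 = vtx k" "act k = G" using applied_at_imp_vtx[OF x0] .
  then obtain m where m: "gpos m = k"
    using enumerate_Ex[OF infinite_g_positions, of k] by (auto simp: gpos_def g_positions_def)
  have entry: "Y ! i = gap (m + i)" if "i < ?n" "x i = vtx (gpos (m + i))" for i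
    using gap_eqI[of "Y ! i" "m + i"] run[OF that(1)] stop[OF that(1)] that(2) by simp
  have "i < ?n \<Longrightarrow> x i = vtx (gpos (m + i))" for i
  proof (induction i)
    case 0
    then show ?case using k m by simp
  next
    case (Suc i)
    then have i: "i < ?n" "x i = vtx (gpos (m + i))" by simp_all
    have "x (Suc i) = (apply_op F ^^ gap (m + i)) (apply_op G (vtx (gpos (m + i))))"
      using nxt[OF i(1)] Suc.prems entry[OF i] i(2) by simp
    also have "\<dots> = vtx (gpos (m + Suc i))"
      by (simp only: iterate_in_gap gpos_Suc add_Suc_right order_refl)
    finally show ?case .
  qed
  then have "Y = window m"
    using entry len by (intro nth_equalityI) (simp_all add: window_def)
  then show thesis by (rule that)
qed

lemma object_represents_iff: "object_represents P C \<longleftrightarrow> P = object_of (window 0)"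
  unfolding object_represents_def
  by (metis object_of_rotate represents_imp_window window_eq_rotate window_represents)

lemma polygon_in_object_of_window: "polygon_in (g_count C) (object_of (window 0))"
  using polygon_in_object_of[of "window 0"] g_count_pos by (simp add: window_def)

end

theorem theorem5:
  fixes C :: "(nat \<times> op) list" and n :: nat
  assumes "collatz_cycle C"
    and "g_count C = n"
  shows "\<exists>!P. polygon_in n P \<and> object_represents P C"
proof -
  interpret loosened_cycle C by unfold_locales (rule assms(1))
  show ?thesis
    using polygon_in_object_of_window assms(2) by (auto simp: object_represents_iff)
qed

end
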